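(* For every $n\ge0$, the Hermite function $\phi_n$ is a stationary wave of both the quintic and the cubic resonant Hamiltonian systems: there are $\omega_n,\omega_n'\in\mathbb{R}$ such that $u(x,t)=e^{i\omega_nt}\phi_n(x)$ solves $iu_t=\mathcal{T}_6(u,u,u,u,u)$ and $u(x,t)=e^{i\omega_n't}\phi_n(x)$ solves $iu_t=\mathcal{T}_4(u,u,u)$.
   Context: $H=-\Delta+x^2$ on $L^2(\mathbb{R})$; the Hermite functions $\{\phi_n\}_{n\ge0}$ are the $L^2$-normalized eigenfunctions, $H\phi_n=(2n+1)\phi_n$ (each a polynomial times $e^{-x^2/2}$), forming an orthonormal basis of $L^2$. $e^{itH}$ is the unitary propagator of $iu_t+Hu=0$, so $e^{itH}\phi_n=e^{it(2n+1)}\phi_n$. The operators are $$\mathcal{T}_6(u,u,u,u,u)=\frac{12}{\pi}\int_{-\pi/4}^{\pi/4}e^{-isH}\left(|e^{isH}u|^4e^{isH}u\right)ds,\qquad \mathcal{T}_4(u,u,u)=\frac{8}{\pi}\int_{-\pi/4}^{\pi/4}e^{-isH}\left(|e^{isH}u|^2e^{isH}u\right)ds,$$ and $iu_t=\mathcal{T}_6(u,\dots,u)$, $iu_t=\mathcal{T}_4(u,u,u)$ are Hamilton's equations for $\mathcal{H}_6(f)=\frac2\pi\int_{-\pi/4}^{\pi/4}\int_{\mathbb{R}}|e^{itH}f|^6dx\,dt$ and $\mathcal{H}_4(f)=\frac2\pi\int_0^{\pi/2}\int_{\mathbb{R}}|e^{itH}f|^4dx\,dt$ respectively. A stationary wave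 is a function $\psi$ such that $e^{i\omega t}\psi(x)$ is a solution for some $\omega\in\mathbb{R}$. *)

theory Defs
  imports "HOL-Probability.Probability" "HOL-Computational_Algebra.Polynomial"
begin

section \<open>Square-integrable functions on the real line\<close>

text \<open>
  Elements of \<open>L\<^sup>2(\<real>)\<close> are represented by Borel functions; equality in \<open>L\<^sup>2\<close> is equality
  almost everywhere. Every notion below that is stated about \<open>L\<^sup>2\<close> respects this equality.
\<close>

definition square_integrable :: "(real \<Rightarrow> complex) \<Rightarrow> bool" where
  "square_integrable f \<longleftrightarrow>
     f \<in> borel_measurable lborel \<and> integrable lborel (\<lambda>x. (cmod (f x))\<^sup>2)"

definition l2_norm :: "(real \<Rightarrow> complex) \<Rightarrow> real" where
  "l2_norm f = sqrt (LBINT x. (cmod (f x))\<^sup>2)"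

definition l2_inner :: "(real \<Rightarrow> complex) \<Rightarrow> (real \<Rightarrow> complex) \<Rightarrow> complex" where
  "l2_inner f g = (LBINT x. f x * cnj (g x))"

text \<open>
  The integral over \<open>[a, b]\<close> of a family \<open>w s\<close> of \<open>L\<^sup>2\<close> functions is taken in the weak (Pettis)
  sense, i.e. after pairing with every element of \<open>L\<^sup>2\<close>. It determines \<open>g\<close> almost everywhere and
  agrees with the Bochner integral whenever the latter exists.
\<close>

definition has_l2_integral ::
    "(real \<Rightarrow> real \<Rightarrow> complex) \<Rightarrow> (real \<Rightarrow> complex) \<Rightarrow> real \<Rightarrow> real \<Rightarrow> bool" where
  "has_l2_integral w g a b \<longleftrightarrow>
     (\<forall>s\<in>{a..b}. square_integrable (w s)) \<and> square_integrable g \<and>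
     (\<forall>h. square_integrable h \<longrightarrow>
        set_integrable lborel {a..b} (\<lambda>s. l2_inner (w s) h) \<and>
        (LBINT s:{a..b}. l2_inner (w s) h) = l2_inner g h)"

definition has_l2_derivative ::
    "(real \<Rightarrow> real \<Rightarrow> complex) \<Rightarrow> (real \<Rightarrow> complex) \<Rightarrow> real \<Rightarrow> bool" where
  "has_l2_derivative u u' t \<longleftrightarrow>
     (\<forall>s. square_integrable (u s)) \<and> square_integrable u' \<and>
     ((\<lambda>h. l2_norm (\<lambda>x. (u (t + h) x - u t x) / complex_of_real h - u' x)) \<longlongrightarrow> 0) (at 0)"

section \<open>Hermite functions\<close>

text \<open>
  The \<open>L\<^sup>2\<close>-normalized eigenfunctions of \<open>H = - d\<^sup>2/dx\<^sup>2 + x\<^sup>2\<close> with eigenvalue \<open>2 n + 1\<close>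
  of the form real polynomial times Gaussian. This determines the function up to a sign.
\<close>

definition hermite_function :: "nat \<Rightarrow> (real \<Rightarrow> complex) \<Rightarrow> bool" where
  "hermite_function n f \<longleftrightarrow>
     (\<exists>p :: real poly. \<forall>x. f x = complex_of_real (poly p x * exp (- x\<^sup>2 / 2))) \<and>
     (\<exists>f' f''. \<forall>x. (f has_vector_derivative f' x) (at x) \<and>
                   (f' has_vector_derivative f'' x) (at x) \<and>
                   - f'' x + complex_of_real (x\<^sup>2) * f x = of_nat (2 * n + 1) * f x) \<and>
     l2_norm f = 1"

definition hermite :: "nat \<Rightarrow> real \<Rightarrow> complex" where
  "hermite n = (SOME f. hermite_function n f)"

text \<open>The choice is legitimate: suitable functions exist, built from the Hermite polynomials.\<close>

fun hermite_poly :: "nat \<Rightarrow> real poly" where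
  "hermite_poly 0 = 1"
| "hermite_poly (Suc n) = [:0, 2:] * hermite_poly n - pderiv (hermite_poly n)"

lemma pderiv2_hermite_poly:
  "pderiv (pderiv (hermite_poly n)) =
     [:0, 2:] * pderiv (hermite_poly n) - smult (2 * real n) (hermite_poly n)"
  and pderiv_hermite_poly_Suc:
  "pderiv (hermite_poly (Suc n)) = smult (2 * real n + 2) (hermite_poly n)"
proof -
  have *: "pderiv (hermite_poly (Suc n)) = smult (2 * real n + 2) (hermite_poly n)"
    if "pderiv (pderiv (hermite_poly n)) =
      [:0, 2:] * pderiv (hermite_poly n) - smult (2 * real n) (hermite_poly n)" for n
    using that by (simp add: pderiv_diff pderiv_mult pderiv_pCons pderiv_add pderiv_smult
        algebra_simps smult_add_left)
  show **: "pderiv (pderiv (hermite_poly n)) =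
     [:0, 2:] * pderiv (hermite_poly n) - smult (2 * real n) (hermite_poly n)" for n
  proof (induction n)
    case 0
    then show ?case by (simp add: pderiv_1)
  next
    case (Suc n)
    show ?case unfolding *[OF Suc]
      by (simp add: pderiv_smult pderiv_add algebra_simps smult_add_left smult_diff_right)
  qed
  show "pderiv (hermite_poly (Suc n)) = smult (2 * real n + 2) (hermite_poly n)"
    by (rule *[OF **])
qed

lemma hermite_poly_nonzero: "hermite_poly n \<noteq> 0"
proof (induction n)
  case (Suc n)
  then show ?case using pderiv_hermite_poly_Suc[of n]
    by (metis add_nonneg_eq_0_iff mult_nonneg_nonneg of_nat_0_le_iff pderiv_0 smult_eq_0_iff
        zero_le_numeral zero_neq_numeral)
qed simp

lemma integrable_poly_gaussian: "integrable lborel (\<lambda>x::real. poly p x * exp (- x\<^sup>2))"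
proof -
  have "integrable lborel (\<lambda>x::real. exp (- x\<^sup>2) * x ^ k)" for k
  proof -
    have "integrable lborel (\<lambda>x. sqrt pi * (normal_density 0 (1 / sqrt 2) x * (x - 0) ^ k))"
      by (intro integrable_mult_right integrable_normal_moment) simp
    then show ?thesis
      by (simp add: normal_density_def power_divide)
  qed
  then have "integrable lborel (\<lambda>x. \<Sum>k\<le>degree p. coeff p k * (exp (- x\<^sup>2) * x ^ k))"
    by (intro Bochner_Integration.integrable_sum integrable_mult_right)
  then show ?thesis
    by (simp add: poly_altdef sum_distrib_left sum_distrib_right mult_ac)
qed

lemma hermite_function_exists: "\<exists>f. hermite_function n f"
proof -
  define h where "h = hermite_poly n"
  define I where "I = (LBINT x. (poly h x)\<^sup>2 * exp (- x\<^sup>2))"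
  have int: "integrable lborel (\<lambda>x. (poly h x)\<^sup>2 * exp (- x\<^sup>2))"
    using integrable_poly_gaussian[of "h\<^sup>2"] by simp
  have "I \<noteq> 0"
  proof
    assume "I = 0"
    then have "AE x in lborel. (poly h x)\<^sup>2 * exp (- x\<^sup>2) = 0"
      using int by (subst (asm) I_def, subst (asm) integral_nonneg_eq_0_iff_AE) auto
    moreover have "finite {x. poly h x = 0}"
      unfolding h_def by (intro poly_roots_finite hermite_poly_nonzero)
    then have "AE x in lborel. x \<notin> {x. poly h x = 0}"
      by (intro AE_not_in countable_imp_null_set_lborel countable_finite)
    ultimately have "AE x::real in lborel. False"
      by eventually_elim auto
    then show False
      by (simp add: AE_iff_null null_sets_def)
  qed
  moreover have "I \<ge> 0"
    unfolding I_def by (intro integral_nonneg_AE) auto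
  ultimately have I: "I > 0" by simp
  define p where "p = smult (1 / sqrt I) h"
  define f where "f = (\<lambda>x. complex_of_real (poly p x * exp (- x\<^sup>2 / 2)))"
  define f' where "f' = (\<lambda>x. complex_of_real ((poly (pderiv p) x - x * poly p x) * exp (- x\<^sup>2 / 2)))"
  define f'' where "f'' = (\<lambda>x. complex_of_real
     ((poly (pderiv (pderiv p)) x - poly p x - 2 * x * poly (pderiv p) x + x\<^sup>2 * poly p x) * exp (- x\<^sup>2 / 2)))"
  have d1: "(f has_vector_derivative f' x) (at x)" for x
    unfolding f_def f'_def
    by (rule has_vector_derivative_of_real)
       (auto intro!: derivative_eq_intros simp: algebra_simps)
  have d2: "(f' has_vector_derivative f'' x) (at x)" for x
    unfolding f'_def f''_def
    by (rule has_vector_derivative_of_real)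
       (auto intro!: derivative_eq_intros simp: algebra_simps power2_eq_square)
  have ode: "poly (pderiv (pderiv p)) x = 2 * x * poly (pderiv p) x - 2 * real n * poly p x" for x
    unfolding p_def h_def
    by (simp add: pderiv_smult pderiv2_hermite_poly algebra_simps)
  have e: "- f'' x + complex_of_real (x\<^sup>2) * f x = of_nat (2 * n + 1) * f x" for x
  proof -
    have "- f'' x + complex_of_real (x\<^sup>2) * f x =
        complex_of_real (real (2 * n + 1) * (poly p x * exp (- x\<^sup>2 / 2)))"
      unfolding f_def f''_def ode of_real_mult[symmetric] of_real_minus[symmetric] of_real_add[symmetric]
      by (simp only: of_real_eq_iff) (simp add: algebra_simps)
    then show ?thesis by (simp add: f_def)
  qed
  have "(cmod (f x))\<^sup>2 = (poly h x)\<^sup>2 * exp (- x\<^sup>2) / I" for x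
    using I unfolding f_def p_def norm_of_real
    by (simp add: power_mult_distrib power_divide flip: exp_double)
  then have "l2_norm f = 1"
    using I by (simp add: l2_norm_def I_def[symmetric])
  then have "hermite_function n f"
    unfolding hermite_function_def
    by (intro conjI exI[of _ p] exI[of _ f'] exI[of _ f''] allI d1 d2 e) (simp add: f_def)
  then show ?thesis by blast
qed

lemma hermite_function_hermite: "hermite_function n (hermite n)"
  unfolding hermite_def using hermite_function_exists by (rule someI_ex)

section \<open>The propagator and the resonant systems\<close>

text \<open>
  \<open>propagator t f g\<close> states \<open>g = e\<^bsup>itH\<^esup> f\<close> in \<open>L\<^sup>2\<close>, where \<open>e\<^bsup>itH\<^esup>\<close> is given by the spectral
  expansion of \<open>H\<close> in its eigenbasis. The sign choice in \<^const>\<open>hermite\<close> is immaterial here.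
\<close>

definition propagator :: "real \<Rightarrow> (real \<Rightarrow> complex) \<Rightarrow> (real \<Rightarrow> complex) \<Rightarrow> bool" where
  "propagator t f g \<longleftrightarrow> square_integrable f \<and> square_integrable g \<and>
     (\<lambda>N. l2_norm (\<lambda>x. g x - (\<Sum>k<N. exp (\<i> * complex_of_real t * of_nat (2 * k + 1)) *
                                      l2_inner f (hermite k) * hermite k x)))
       \<longlonglongrightarrow> 0"

text \<open>
  \<open>resonant_operator c p u g\<close> states
  \<open>g = c \<integral>\<^bsub>[-\<pi>/4, \<pi>/4]\<^esub> e\<^bsup>-isH\<^esup> (|e\<^bsup>isH\<^esup> u|\<^sup>p e\<^bsup>isH\<^esup> u) ds\<close>. It is a relation because it also asserts
  that the right-hand side is meaningful: the nonlinearity lies in \<open>L\<^sup>2\<close> for each \<open>s\<close>.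
\<close>

definition resonant_operator ::
    "real \<Rightarrow> nat \<Rightarrow> (real \<Rightarrow> complex) \<Rightarrow> (real \<Rightarrow> complex) \<Rightarrow> bool" where
  "resonant_operator c p u g \<longleftrightarrow>
     (\<exists>v w. (\<forall>s\<in>{-pi/4..pi/4}.
               propagator s u (v s) \<and>
               propagator (- s) (\<lambda>x. complex_of_real (cmod (v s x) ^ p) * v s x) (w s)) \<and>
            has_l2_integral (\<lambda>s x. complex_of_real c * w s x) g (-pi/4) (pi/4))"

definition T6 :: "(real \<Rightarrow> complex) \<Rightarrow> (real \<Rightarrow> complex) \<Rightarrow> bool" where
  "T6 = resonant_operator (12 / pi) 4"

definition T4 :: "(real \<Rightarrow> complex) \<Rightarrow> (real \<Rightarrow> complex) \<Rightarrow> bool" where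
  "T4 = resonant_operator (8 / pi) 2"

text \<open>\<open>i u\<^sub>t = T(u)\<close> for all times, with \<open>u\<^sub>t\<close> the derivative in \<open>L\<^sup>2\<close>.\<close>

definition solves ::
    "((real \<Rightarrow> complex) \<Rightarrow> (real \<Rightarrow> complex) \<Rightarrow> bool) \<Rightarrow> (real \<Rightarrow> real \<Rightarrow> complex) \<Rightarrow> bool" where
  "solves T u \<longleftrightarrow> (\<forall>t. \<exists>u'. has_l2_derivative u u' t \<and> T (u t) (\<lambda>x. \<i> * u' x))"

definition stationary_wave ::
    "((real \<Rightarrow> complex) \<Rightarrow> (real \<Rightarrow> complex) \<Rightarrow> bool) \<Rightarrow> (real \<Rightarrow> complex) \<Rightarrow> bool" where
  "stationary_wave T \<psi> \<longleftrightarrow>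
     (\<exists>\<omega>::real. solves T (\<lambda>t x. exp (\<i> * complex_of_real (\<omega> * t)) * \<psi> x))"

end

(* The phase e^{i omega t} factors out of the resonant operator, so it suffices to apply the operator
   to phi_n. With F = |phi_n|^p phi_n, the integrand is the Hermite series of F with k-th coefficient
   c_k = <F, phi_k> multiplied by e^{2is(n - k)}. Because F has the parity of phi_n, c_k vanishes for
   n - k odd; for n - k even and nonzero the exponential integrates to zero over [-pi/4, pi/4].
   Only k = n survives, so phi_n is mapped to a real multiple of itself. *)
theory Submission
  imports Defs "HOL-Real_Asymp.Real_Asymp"
begin

section \<open>The Hilbert space of square-integrable functions\<close>

text \<open>Parity compensates for the short window. Over a window of length \<open>pi/2\<close> the
  integral of \<open>exp (2 * \<i> * s * m)\<close> is \<open>sin (m * pi / 2) / m\<close> for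
  \<open>m \<noteq> 0\<close>, which vanishes only for even \<open>m\<close>; odd differences must
  be excluded by the coefficients. The analytic obstacle is exchanging the Hermite series with the
  time integral. The integral is weak, so this is needed only for scalar functions of
  \<open>s\<close>, after pairing with a test function. There Bessel and Cauchy-Schwarz bound every
  partial sum by a product of two norms, uniformly in \<open>s\<close> and in the number of terms,
  and dominated convergence applies. The propagator is a relation, so the backward evolution of
  \<open>F\<close> has to be constructed; this is Riesz-Fischer, and behind it the completeness of
  L2. Finally, \<open>hermite\<close> is an arbitrary choice among the functions satisfying
  \<open>hermite_function\<close>, so orthogonality and parity are extracted from the eigenvalue
  equation itself.\<close>

lemma square_integrable_measurable [measurable_dest]:
  "square_integrable f \<Longrightarrow> f \<in> borel_measurable borel"
  by (simp add: square_integrable_def)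

lemma square_integrable_cmod2: "square_integrable f \<Longrightarrow> integrable lborel (\<lambda>x. (cmod (f x))\<^sup>2)"
  by (simp add: square_integrable_def)

lemma square_integrable_cmult: "square_integrable f \<Longrightarrow> square_integrable (\<lambda>x. a * f x)"
  by (auto simp: square_integrable_def norm_mult power_mult_distrib)

lemma norm_add_squared_le: "(norm (a + b :: 'a :: real_normed_vector))\<^sup>2 \<le> 2 * (norm a)\<^sup>2 + 2 * (norm b)\<^sup>2"
proof -
  have "(norm (a + b))\<^sup>2 \<le> (norm a + norm b)\<^sup>2"
    by (intro power_mono norm_triangle_ineq) auto
  also have "\<dots> \<le> 2 * (norm a)\<^sup>2 + 2 * (norm b)\<^sup>2"
    using sum_squares_bound[of "norm a" "norm b"] by (simp add: power2_sum)
  finally show ?thesis .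
qed

lemma square_integrable_add:
  assumes "square_integrable f" "square_integrable g"
  shows "square_integrable (\<lambda>x. f x + g x)"
proof -
  have [measurable]: "f \<in> borel_measurable borel" "g \<in> borel_measurable borel"
    using assms by (auto intro: square_integrable_measurable)
  have "integrable lborel (\<lambda>x. 2 * (cmod (f x))\<^sup>2 + 2 * (cmod (g x))\<^sup>2)"
    using assms by (auto simp: square_integrable_def)
  then have "integrable lborel (\<lambda>x. (cmod (f x + g x))\<^sup>2)"
    by (rule Bochner_Integration.integrable_bound) (auto intro!: norm_add_squared_le)
  then show ?thesis by (simp add: square_integrable_def)
qed

lemma square_integrable_diff:
  assumes "square_integrable f" "square_integrable g"
  shows "square_integrable (\<lambda>x. f x - g x)"
  using square_integrable_add[OF assms(1) square_integrable_cmult[OF assms(2), of "-1"]] by simp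

lemma square_integrable_sum:
  assumes "\<And>k. k \<in> I \<Longrightarrow> square_integrable (f k)"
  shows "square_integrable (\<lambda>x. \<Sum>k\<in>I. f k x)"
  using assms by (induction I rule: infinite_finite_induct)
    (auto intro!: square_integrable_add simp: square_integrable_def[of "\<lambda>x. 0"])

section \<open>Inner product, norm and the Cauchy-Schwarz inequality\<close>

lemma integrable_l2_inner:
  assumes "square_integrable f" "square_integrable g"
  shows "integrable lborel (\<lambda>x. f x * cnj (g x))"
proof -
  have [measurable]: "f \<in> borel_measurable borel" "g \<in> borel_measurable borel"
    using assms by (auto intro: square_integrable_measurable)
  have [measurable]: "cnj \<in> borel_measurable borel"
    by (intro borel_measurable_continuous_onI continuous_intros)
  have "integrable lborel (\<lambda>x. (cmod (f x))\<^sup>2 + (cmod (g x))\<^sup>2)"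
    using assms by (auto simp: square_integrable_def)
  then show ?thesis
  proof (rule Bochner_Integration.integrable_bound)
    show "AE x in lborel. norm (f x * cnj (g x)) \<le> norm ((cmod (f x))\<^sup>2 + (cmod (g x))\<^sup>2)"
    proof (rule AE_I2)
      fix x
      have "2 * (cmod (f x) * cmod (g x)) \<le> (cmod (f x))\<^sup>2 + (cmod (g x))\<^sup>2"
        using sum_squares_bound[of "cmod (f x)" "cmod (g x)"] by simp
      moreover have "0 \<le> cmod (f x) * cmod (g x)" by simp
      ultimately have "cmod (f x) * cmod (g x) \<le> (cmod (f x))\<^sup>2 + (cmod (g x))\<^sup>2" by linarith
      then show "norm (f x * cnj (g x)) \<le> norm ((cmod (f x))\<^sup>2 + (cmod (g x))\<^sup>2)"
        by (simp add: norm_mult)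
    qed
  qed simp
qed

lemma l2_inner_add_left:
  "square_integrable f \<Longrightarrow> square_integrable g \<Longrightarrow> square_integrable h \<Longrightarrow>
     l2_inner (\<lambda>x. f x + g x) h = l2_inner f h + l2_inner g h"
  by (simp add: l2_inner_def distrib_right integrable_l2_inner)

lemma l2_inner_cmult_left: "l2_inner (\<lambda>x. a * f x) h = a * l2_inner f h"
  by (simp add: l2_inner_def mult.assoc)

lemma l2_inner_cnj: "cnj (l2_inner f g) = l2_inner g f"
  unfolding l2_inner_def
  by (subst Bochner_Integration.integral_cnj [symmetric]) (simp add: mult.commute)

lemma l2_inner_diff_left:
  "square_integrable f \<Longrightarrow> square_integrable g \<Longrightarrow> square_integrable h \<Longrightarrow>
     l2_inner (\<lambda>x. f x - g x) h = l2_inner f h - l2_inner g h"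
  by (simp add: l2_inner_def left_diff_distrib integrable_l2_inner)

lemma l2_inner_diff_right:
  "square_integrable f \<Longrightarrow> square_integrable g \<Longrightarrow> square_integrable h \<Longrightarrow>
     l2_inner h (\<lambda>x. f x - g x) = l2_inner h f - l2_inner h g"
  by (simp add: l2_inner_def right_diff_distrib integrable_l2_inner)

lemma l2_inner_sum_left:
  assumes "\<And>k. k \<in> I \<Longrightarrow> square_integrable (f k)" "square_integrable h"
  shows "l2_inner (\<lambda>x. \<Sum>k\<in>I. f k x) h = (\<Sum>k\<in>I. l2_inner (f k) h)"
  using assms
  by (induction I rule: infinite_finite_induct)
    (auto simp: l2_inner_add_left square_integrable_sum, simp_all add: l2_inner_def)

lemma l2_norm_squared: "(l2_norm f)\<^sup>2 = (LBINT x. (cmod (f x))\<^sup>2)"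
  by (simp add: l2_norm_def integral_nonneg_AE)

lemma l2_norm_nonneg: "l2_norm f \<ge> 0"
  by (simp add: l2_norm_def integral_nonneg_AE)

lemma l2_norm_cmult: "l2_norm (\<lambda>x. a * f x) = cmod a * l2_norm f"
  by (simp add: l2_norm_def norm_mult power_mult_distrib real_sqrt_mult)

lemma l2_inner_self: "l2_inner f f = of_real ((l2_norm f)\<^sup>2)"
  unfolding l2_norm_squared l2_inner_def complex_norm_square [symmetric]
  by (rule integral_complex_of_real)

text \<open>Follows by integrating \<open>2 (a |f|) (b |g|) \<le> a^2 |f|^2 + b^2 |g|^2\<close> and
  choosing the weights \<open>a\<close>, \<open>b\<close> well. The moduli stand inside the integral
  because \<open>l2_complete\<close> needs an L1 estimate.\<close>

lemma l2_cauchy_schwarz_abs: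
  assumes f: "square_integrable f" and g: "square_integrable g"
  shows "(LBINT x. cmod (f x) * cmod (g x)) \<le> l2_norm f * l2_norm g"
proof -
  have [measurable]: "f \<in> borel_measurable borel" "g \<in> borel_measurable borel"
    using assms by (auto intro: square_integrable_measurable)
  define I where "I = (LBINT x. cmod (f x) * cmod (g x))"
  have int: "integrable lborel (\<lambda>x. cmod (f x) * cmod (g x))"
    using integrable_norm[OF integrable_l2_inner[OF f g]] by (simp add: norm_mult)
  have int2: "integrable lborel (\<lambda>x. (cmod (f x))\<^sup>2)" "integrable lborel (\<lambda>x. (cmod (g x))\<^sup>2)"
    using f g by (auto simp: square_integrable_def)
  have quad: "2 * I * (a * b) \<le> a\<^sup>2 * (l2_norm f)\<^sup>2 + b\<^sup>2 * (l2_norm g)\<^sup>2" for a b :: real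
  proof -
    have "2 * I * (a * b) = (LBINT x. 2 * a * b * (cmod (f x) * cmod (g x)))"
      by (simp add: I_def)
    also have "\<dots> \<le> (LBINT x. a\<^sup>2 * (cmod (f x))\<^sup>2 + b\<^sup>2 * (cmod (g x))\<^sup>2)"
      using int int2 sum_squares_bound[of "a * cmod (f x)" "b * cmod (g x)" for x]
      by (intro integral_mono) (auto simp: power_mult_distrib mult_ac)
    also have "\<dots> = a\<^sup>2 * (l2_norm f)\<^sup>2 + b\<^sup>2 * (l2_norm g)\<^sup>2"
      using int2 by (simp add: l2_norm_squared)
    finally show ?thesis .
  qed
  have I0: "I \<ge> 0" unfolding I_def by (intro integral_nonneg_AE) auto
  have "I\<^sup>2 \<le> (l2_norm f * l2_norm g)\<^sup>2"
  proof (cases "l2_norm g = 0")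
    case True
    have "I = 0"
    proof (rule ccontr)
      assume "I \<noteq> 0"
      then have "I > 0" using I0 by simp
      \<comment> \<open>With \<open>l2_norm g = 0\<close> the bound reads
        \<open>2 * I * b \<le> (l2_norm f)^2\<close>; this \<open>b\<close> makes the left side
        exceed the right by 1.\<close>
      then show False
        using quad[of 1 "((l2_norm f)\<^sup>2 + 1) / (2 * I)"] True by (simp add: field_simps)
    qed
    then show ?thesis by simp
  next
    case False
    then have "(l2_norm g)\<^sup>2 > 0" by simp
    \<comment> \<open>For given \<open>a\<close> the best \<open>b\<close> is
      \<open>a * I / (l2_norm g)^2\<close>; taking \<open>a = (l2_norm g)^2\<close> clears the
      denominator.\<close>
    moreover have "2 * I * ((l2_norm g)\<^sup>2 * I) \<le> (l2_norm g)\<^sup>2 * (l2_norm g)\<^sup>2 * (l2_norm f)\<^sup>2 + I\<^sup>2 * (l2_norm g)\<^sup>2"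
      using quad[of "(l2_norm g)\<^sup>2" I] by (simp add: power2_eq_square)
    then have "(l2_norm g)\<^sup>2 * I\<^sup>2 \<le> (l2_norm g)\<^sup>2 * ((l2_norm g)\<^sup>2 * (l2_norm f)\<^sup>2)"
      by (simp add: power2_eq_square algebra_simps)
    ultimately show ?thesis
      by (simp add: power_mult_distrib mult.commute)
  qed
  then show ?thesis
    unfolding I_def [symmetric]
    by (rule power2_le_imp_le) (simp add: l2_norm_nonneg)
qed

lemma l2_cauchy_schwarz:
  assumes "square_integrable f" "square_integrable g"
  shows "cmod (l2_inner f g) \<le> l2_norm f * l2_norm g"
proof -
  have "cmod (l2_inner f g) \<le> (LBINT x. cmod (f x * cnj (g x)))"
    unfolding l2_inner_def by (rule integral_norm_bound)
  also have "\<dots> \<le> l2_norm f * l2_norm g"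
    using l2_cauchy_schwarz_abs[OF assms] by (simp add: norm_mult)
  finally show ?thesis .
qed

section \<open>Completeness of L2\<close>

lemma square_integrable_poly_gaussian:
  "square_integrable (\<lambda>x. complex_of_real (poly p x * exp (- x\<^sup>2 / 2)))"
proof -
  have "(\<lambda>x. (cmod (complex_of_real (poly p x * exp (- x\<^sup>2 / 2))))\<^sup>2) = (\<lambda>x. poly (p\<^sup>2) x * exp (- x\<^sup>2))"
    unfolding norm_of_real by (simp add: power_mult_distrib flip: exp_double)
  moreover have [measurable]: "poly p \<in> borel_measurable borel"
    by (intro borel_measurable_continuous_onI continuous_intros)
  ultimately show ?thesis
    using integrable_poly_gaussian[of "p\<^sup>2"] by (simp add: square_integrable_def)
qed

text \<open>An almost everywhere convergent subsequence supplies the limit, and Fatou's lemma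
  carries the Cauchy bound over to the distance from the limit. Only one of the two indices runs
  through the subsequence, so the whole sequence converges.\<close>

lemma l2_complete:
  assumes f: "\<And>n. square_integrable (f n)"
    and cauchy: "\<And>e. e > 0 \<Longrightarrow> \<exists>N. \<forall>i\<ge>N. \<forall>j\<ge>N. l2_norm (\<lambda>x. f i x - f j x) < e"
  obtains g where "square_integrable g" "(\<lambda>n. l2_norm (\<lambda>x. g x - f n x)) \<longlonglongrightarrow> 0"
proof -
  have [measurable]: "\<And>n. f n \<in> borel_measurable borel"
    using f by (rule square_integrable_measurable)
  \<comment> \<open>Multiplication by a Gaussian maps \<open>L\<^sup>2\<close> into \<open>L\<^sup>1\<close>, where a.e. convergent subsequences are available.\<close>
  define w where "w = (\<lambda>x. complex_of_real (poly 1 x * exp (- x\<^sup>2 / 2)))"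
  have w: "square_integrable w" unfolding w_def by (rule square_integrable_poly_gaussian)
  have w_cnj: "cnj (w x) = w x" for x by (simp add: w_def)
  have w0: "w x \<noteq> 0" for x by (simp add: w_def)
  obtain r where r: "strict_mono r" and ae: "AE x in lborel. Cauchy (\<lambda>i. f (r i) x * w x)"
  proof (rule cauchy_L1_AE_cauchy_subseq[where s = "\<lambda>n x. f n x * w x" and M = lborel])
    show "integrable lborel (\<lambda>x. f n x * w x)" for n
      using integrable_l2_inner[OF f w] by (simp add: w_cnj)
    show "\<exists>N. \<forall>i\<ge>N. \<forall>j\<ge>N. (LBINT x. norm (f i x * w x - f j x * w x)) < e" if "e > 0" for e :: real
    proof -
      \<comment> \<open>Adding 1 gives a positive denominator without evaluating the norm of the
        Gaussian.\<close>
      have "0 < l2_norm w + 1" using l2_norm_nonneg[of w] by simp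
      then have "e / (l2_norm w + 1) > 0" using \<open>e > 0\<close> by simp
      then obtain N where N: "\<And>i j. i \<ge> N \<Longrightarrow> j \<ge> N \<Longrightarrow> l2_norm (\<lambda>x. f i x - f j x) < e / (l2_norm w + 1)"
        using cauchy by blast
      have "(LBINT x. norm (f i x * w x - f j x * w x)) < e" if ij: "i \<ge> N" "j \<ge> N" for i j
      proof -
        have "(LBINT x. norm (f i x * w x - f j x * w x)) = (LBINT x. cmod (f i x - f j x) * cmod (w x))"
          by (simp flip: norm_mult left_diff_distrib)
        also have "\<dots> \<le> l2_norm (\<lambda>x. f i x - f j x) * l2_norm w"
          by (intro l2_cauchy_schwarz_abs square_integrable_diff f w)
        also have "\<dots> \<le> l2_norm (\<lambda>x. f i x - f j x) * (l2_norm w + 1)"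
          by (intro mult_left_mono l2_norm_nonneg) simp
        also have "\<dots> < e"
          using N[OF ij] \<open>0 < l2_norm w + 1\<close> by (simp add: field_simps)
        finally show ?thesis .
      qed
      then show ?thesis by blast
    qed
  qed
  define g where "g = (\<lambda>x. lim (\<lambda>i. f (r i) x))"
  have [measurable]: "g \<in> borel_measurable borel" unfolding g_def by measurable
  have lim: "AE x in lborel. (\<lambda>i. f (r i) x) \<longlonglongrightarrow> g x"
    using ae
  proof eventually_elim
    case (elim x)
    then have "convergent (\<lambda>i. f (r i) x * w x)" by (simp add: Cauchy_convergent_iff)
    \<comment> \<open>The weight has no zeros, so it can be divided out pointwise.\<close>
    then have "convergent (\<lambda>i. f (r i) x * w x * (1 / w x))"
      by (rule convergent_mult) (rule convergent_const)
    then show ?case using w0[of x] by (simp add: g_def convergent_LIMSEQ_iff)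
  qed
  have fatou: "(\<integral>\<^sup>+x. ennreal ((cmod (g x - f n x))\<^sup>2) \<partial>lborel) \<le> ennreal (e\<^sup>2)"
    if N: "\<And>i. i \<ge> N \<Longrightarrow> l2_norm (\<lambda>x. f i x - f n x) < e" and "e > 0" for n N e
  proof -
    have "(\<integral>\<^sup>+x. ennreal ((cmod (g x - f n x))\<^sup>2) \<partial>lborel)
        = (\<integral>\<^sup>+x. liminf (\<lambda>i. ennreal ((cmod (f (r i) x - f n x))\<^sup>2)) \<partial>lborel)"
    proof (rule nn_integral_cong_AE)
      show "AE x in lborel. ennreal ((cmod (g x - f n x))\<^sup>2)
          = liminf (\<lambda>i. ennreal ((cmod (f (r i) x - f n x))\<^sup>2))"
        using lim
      proof eventually_elim
        case (elim x)
        then have "(\<lambda>i. ennreal ((cmod (f (r i) x - f n x))\<^sup>2)) \<longlonglongrightarrow> ennreal ((cmod (g x - f n x))\<^sup>2)"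
          by (intro tendsto_intros)
        from lim_imp_Liminf[OF sequentially_bot this] show ?case by (rule sym)
      qed
    qed
    also have "\<dots> \<le> liminf (\<lambda>i. \<integral>\<^sup>+x. ennreal ((cmod (f (r i) x - f n x))\<^sup>2) \<partial>lborel)"
      by (rule nn_integral_liminf) simp
    also have "\<dots> \<le> limsup (\<lambda>i. \<integral>\<^sup>+x. ennreal ((cmod (f (r i) x - f n x))\<^sup>2) \<partial>lborel)"
      by (rule Liminf_le_Limsup) simp
    also have "\<dots> \<le> ennreal (e\<^sup>2)"
    proof (rule Limsup_bounded)
      show "\<forall>\<^sub>F i in sequentially. (\<integral>\<^sup>+x. ennreal ((cmod (f (r i) x - f n x))\<^sup>2) \<partial>lborel) \<le> ennreal (e\<^sup>2)"
        using eventually_ge_at_top[of N]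
      proof eventually_elim
        case (elim i)
        then have "r i \<ge> N" using seq_suble[OF r, of i] by linarith
        have "(\<integral>\<^sup>+x. ennreal ((cmod (f (r i) x - f n x))\<^sup>2) \<partial>lborel)
            = ennreal ((l2_norm (\<lambda>x. f (r i) x - f n x))\<^sup>2)"
          unfolding l2_norm_squared
          by (intro nn_integral_eq_integral square_integrable_cmod2 square_integrable_diff f) auto
        also have "\<dots> \<le> ennreal (e\<^sup>2)"
          using N[OF \<open>r i \<ge> N\<close>] l2_norm_nonneg by (intro ennreal_leI power_mono) auto
        finally show ?case .
      qed
    qed
    finally show ?thesis .
  qed
  have sq: "square_integrable (\<lambda>x. g x - f n x)"
    if "(\<integral>\<^sup>+x. ennreal ((cmod (g x - f n x))\<^sup>2) \<partial>lborel) \<le> ennreal c" for n c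
  proof -
    have "(\<integral>\<^sup>+x. ennreal ((cmod (g x - f n x))\<^sup>2) \<partial>lborel) < \<infinity>"
      using that by (rule le_less_trans) simp
    then show ?thesis
      unfolding square_integrable_def by (auto intro!: integrableI_nonneg)
  qed
  have g: "square_integrable g"
  proof -
    obtain N where "\<And>i j. i \<ge> N \<Longrightarrow> j \<ge> N \<Longrightarrow> l2_norm (\<lambda>x. f i x - f j x) < 1"
      using cauchy[of 1] by auto
    then have "square_integrable (\<lambda>x. g x - f N x)"
      by (intro sq[OF fatou[of N N 1]]) auto
    then show ?thesis
      using square_integrable_add[OF _ f[of N]] by fastforce
  qed
  moreover have "(\<lambda>n. l2_norm (\<lambda>x. g x - f n x)) \<longlonglongrightarrow> 0"
  proof (rule LIMSEQ_I)
    fix e :: real assume "e > 0"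
    then obtain N where N: "\<And>i j. i \<ge> N \<Longrightarrow> j \<ge> N \<Longrightarrow> l2_norm (\<lambda>x. f i x - f j x) < e / 2"
      using cauchy[of "e / 2"] by auto
    have "l2_norm (\<lambda>x. g x - f n x) \<le> e / 2" if "n \<ge> N" for n
    proof -
      have "(LBINT x. (cmod (g x - f n x))\<^sup>2) \<le> (e / 2)\<^sup>2"
        using fatou[of N n "e / 2"] N that \<open>e > 0\<close> by (intro integral_real_bounded) auto
      then have "(l2_norm (\<lambda>x. g x - f n x))\<^sup>2 \<le> (e / 2)\<^sup>2"
        by (simp only: l2_norm_squared)
      then show ?thesis
        by (rule power2_le_imp_le) (use \<open>e > 0\<close> in simp)
    qed
    then have "norm (l2_norm (\<lambda>x. g x - f n x) - 0) < e" if "n \<ge> N" for n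
      using \<open>e > 0\<close> that l2_norm_nonneg[of "\<lambda>x. g x - f n x"] by fastforce
    then show "\<exists>N. \<forall>n\<ge>N. norm (l2_norm (\<lambda>x. g x - f n x) - 0) < e"
      by blast
  qed
  ultimately show thesis by (rule that)
qed

section \<open>Orthonormal sequences\<close>

definition l2_orthonormal :: "(nat \<Rightarrow> real \<Rightarrow> complex) \<Rightarrow> bool" where
  "l2_orthonormal e \<longleftrightarrow> (\<forall>k. square_integrable (e k)) \<and>
     (\<forall>j k. l2_inner (e j) (e k) = (if j = k then 1 else 0))"

context
  fixes e :: "nat \<Rightarrow> real \<Rightarrow> complex"
  assumes e: "l2_orthonormal e"
begin

lemma square_integrable_orthonormal_sum: "square_integrable (\<lambda>x. \<Sum>k\<in>A. c k * e k x)"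
  using e by (auto simp: l2_orthonormal_def intro!: square_integrable_sum square_integrable_cmult)

lemma l2_inner_orthonormal_sum:
  "square_integrable h \<Longrightarrow> l2_inner (\<lambda>x. \<Sum>k\<in>A. c k * e k x) h = (\<Sum>k\<in>A. c k * l2_inner (e k) h)"
  using e by (subst l2_inner_sum_left)
    (auto simp: l2_orthonormal_def l2_inner_cmult_left intro!: square_integrable_cmult)

lemma l2_norm_orthonormal_sum:
  assumes "finite A"
  shows "(l2_norm (\<lambda>x. \<Sum>k\<in>A. c k * e k x))\<^sup>2 = (\<Sum>k\<in>A. (cmod (c k))\<^sup>2)"
proof -
  let ?S = "\<lambda>x. \<Sum>k\<in>A. c k * e k x"
  have "l2_inner (e k) ?S = cnj (c k)" if "k \<in> A" for k
  proof -
    have "cnj (l2_inner (e k) ?S) = (\<Sum>j\<in>A. c j * l2_inner (e j) (e k))"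
      using e by (simp add: l2_inner_cnj l2_inner_orthonormal_sum l2_orthonormal_def)
    also have "\<dots> = (\<Sum>j\<in>A. if j = k then c j else 0)"
      using e by (intro sum.cong) (auto simp: l2_orthonormal_def)
    also have "\<dots> = c k" using assms that by simp
    finally show ?thesis by (metis complex_cnj_cnj)
  qed
  then have "l2_inner ?S ?S = of_real (\<Sum>k\<in>A. (cmod (c k))\<^sup>2)"
    by (simp add: l2_inner_orthonormal_sum square_integrable_orthonormal_sum complex_norm_square
        del: of_real_power)
  then show ?thesis unfolding l2_inner_self of_real_eq_iff .
qed

text \<open>The squared distance from \<open>f\<close> to its projection \<open>S\<close> is
  \<open>(l2_norm f)^2 - B\<close>, which cannot be negative.\<close>

lemma bessel_inequality:
  assumes f: "square_integrable f" and "finite A"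
  shows "(\<Sum>k\<in>A. (cmod (l2_inner f (e k)))\<^sup>2) \<le> (l2_norm f)\<^sup>2"
proof -
  define S where "S = (\<lambda>x. \<Sum>k\<in>A. l2_inner f (e k) * e k x)"
  define B where "B = (\<Sum>k\<in>A. (cmod (l2_inner f (e k)))\<^sup>2)"
  have S: "square_integrable S" unfolding S_def by (rule square_integrable_orthonormal_sum)
  have SS: "l2_inner S S = of_real B"
    unfolding l2_inner_self of_real_eq_iff S_def B_def by (rule l2_norm_orthonormal_sum[OF \<open>finite A\<close>])
  have Sf: "l2_inner S f = of_real B"
    unfolding S_def B_def
    by (subst l2_inner_orthonormal_sum[OF f])
       (simp add: complex_norm_square l2_inner_cnj del: of_real_power)
  then have fS: "l2_inner f S = of_real B"
    by (metis l2_inner_cnj complex_cnj_complex_of_real)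
  have "complex_of_real ((l2_norm (\<lambda>x. f x - S x))\<^sup>2) = l2_inner (\<lambda>x. f x - S x) (\<lambda>x. f x - S x)"
    by (simp only: l2_inner_self)
  also have "\<dots> = l2_inner f f - l2_inner S f - (l2_inner f S - l2_inner S S)"
    using f S by (simp add: l2_inner_diff_left l2_inner_diff_right square_integrable_diff)
  also have "\<dots> = of_real ((l2_norm f)\<^sup>2 - B)"
    by (simp add: SS Sf fS l2_inner_self[of f])
  finally have "(l2_norm (\<lambda>x. f x - S x))\<^sup>2 = (l2_norm f)\<^sup>2 - B"
    unfolding of_real_eq_iff .
  then show ?thesis unfolding B_def [symmetric]
    by (metis diff_ge_0_iff_ge zero_le_power2)
qed

lemma bessel_summable:
  assumes "square_integrable f"
  shows "summable (\<lambda>k. (cmod (l2_inner f (e k)))\<^sup>2)"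
  by (rule summableI_nonneg_bounded[where x = "(l2_norm f)\<^sup>2"])
     (use bessel_inequality[OF assms] in auto)

text \<open>By orthonormality the squared distance of two partial sums is a block of the convergent
  series of \<open>(cmod (c k))^2\<close>, so the partial sums are Cauchy.\<close>

lemma riesz_fischer:
  assumes "summable (\<lambda>k. (cmod (c k))\<^sup>2)"
  obtains g where "square_integrable g"
    "(\<lambda>N. l2_norm (\<lambda>x. g x - (\<Sum>k<N. c k * e k x))) \<longlonglongrightarrow> 0"
proof (rule l2_complete[where f = "\<lambda>N x. \<Sum>k<N. c k * e k x"])
  show "square_integrable (\<lambda>x. \<Sum>k<N. c k * e k x)" for N
    by (rule square_integrable_orthonormal_sum)
  show "\<exists>N. \<forall>i\<ge>N. \<forall>j\<ge>N. l2_norm (\<lambda>x. (\<Sum>k<i. c k * e k x) - (\<Sum>k<j. c k * e k x)) < r"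
    if "r > 0" for r :: real
  proof -
    have "r\<^sup>2 > 0" using that by simp
    then obtain N where N: "\<And>m n. m \<ge> N \<Longrightarrow> norm (\<Sum>k\<in>{m..<n}. (cmod (c k))\<^sup>2) < r\<^sup>2"
      using assms unfolding summable_Cauchy by blast
    have le: "l2_norm (\<lambda>x. (\<Sum>k<i. c k * e k x) - (\<Sum>k<j. c k * e k x)) < r"
      if "N \<le> j" "j \<le> i" for i j
    proof -
      have "(\<Sum>k<i. c k * e k x) - (\<Sum>k<j. c k * e k x) = (\<Sum>k\<in>{j..<i}. c k * e k x)" for x
        using sum_diff_nat_ivl[of 0 j i "\<lambda>k. c k * e k x"] that by (simp add: atLeast0LessThan)
      then have "(l2_norm (\<lambda>x. (\<Sum>k<i. c k * e k x) - (\<Sum>k<j. c k * e k x)))\<^sup>2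
          = (\<Sum>k\<in>{j..<i}. (cmod (c k))\<^sup>2)"
        by (simp add: l2_norm_orthonormal_sum)
      also have "\<dots> < r\<^sup>2"
        using N[OF \<open>N \<le> j\<close>, of i] by simp
      finally show ?thesis
        by (rule power2_less_imp_less) (use \<open>r > 0\<close> in simp)
    qed
    have sym: "l2_norm (\<lambda>x. a x - b x) = l2_norm (\<lambda>x. b x - a x)" for a b
      by (simp add: l2_norm_def norm_minus_commute)
    have "l2_norm (\<lambda>x. (\<Sum>k<i. c k * e k x) - (\<Sum>k<j. c k * e k x)) < r"
      if "N \<le> i" "N \<le> j" for i j
    proof (cases "j \<le> i")
      case True
      then show ?thesis using le that by blast
    next
      case False
      then show ?thesis by (subst sym) (use le[of i j] that in simp)
    qed
    then show ?thesis by blast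
  qed
qed (rule that)

text \<open>Norm convergence implies weak convergence, by Cauchy-Schwarz. This turns the L2 limit in
  \<open>propagator\<close> into a scalar series.\<close>

lemma tendsto_l2_inner_expansion:
  assumes g: "square_integrable g" and h: "square_integrable h"
    and lim: "(\<lambda>N. l2_norm (\<lambda>x. g x - (\<Sum>k<N. c k * e k x))) \<longlonglongrightarrow> 0"
  shows "(\<lambda>N. \<Sum>k<N. c k * l2_inner (e k) h) \<longlonglongrightarrow> l2_inner g h"
proof (rule LIM_zero_cancel, rule Lim_null_comparison)
  show "\<forall>\<^sub>F N in sequentially. norm ((\<Sum>k<N. c k * l2_inner (e k) h) - l2_inner g h)
      \<le> l2_norm (\<lambda>x. g x - (\<Sum>k<N. c k * e k x)) * l2_norm h"
  proof (rule always_eventually, rule allI)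
    fix N
    have "l2_inner g h - (\<Sum>k<N. c k * l2_inner (e k) h)
        = l2_inner (\<lambda>x. g x - (\<Sum>k<N. c k * e k x)) h"
      using g h by (simp add: l2_inner_diff_left l2_inner_orthonormal_sum square_integrable_orthonormal_sum)
    then show "norm ((\<Sum>k<N. c k * l2_inner (e k) h) - l2_inner g h)
        \<le> l2_norm (\<lambda>x. g x - (\<Sum>k<N. c k * e k x)) * l2_norm h"
      using l2_cauchy_schwarz[OF square_integrable_diff[OF g square_integrable_orthonormal_sum] h]
      by (simp add: norm_minus_commute)
  qed
  show "(\<lambda>N. l2_norm (\<lambda>x. g x - (\<Sum>k<N. c k * e k x)) * l2_norm h) \<longlonglongrightarrow> 0"
    using tendsto_mult_left_zero[OF lim] .
qed

text \<open>Unimodular factors do not change the norm of a finite orthonormal sum, so Bessel still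
  bounds it by \<open>l2_norm f\<close>. The bound is independent of \<open>N\<close> and
  \<open>z\<close> and becomes the majorant for the time integral.\<close>

lemma multiplier_bound:
  assumes f: "square_integrable f" and h: "square_integrable h" and z: "\<And>k. cmod (z k) = 1"
  shows "cmod (\<Sum>k<N. z k * l2_inner f (e k) * l2_inner (e k) h) \<le> l2_norm f * l2_norm h"
proof -
  define S where "S = (\<lambda>x. \<Sum>k<N. z k * l2_inner f (e k) * e k x)"
  have "(l2_norm S)\<^sup>2 = (\<Sum>k<N. (cmod (l2_inner f (e k)))\<^sup>2)"
    unfolding S_def by (subst l2_norm_orthonormal_sum) (simp_all add: norm_mult z)
  also have "\<dots> \<le> (l2_norm f)\<^sup>2" using f by (intro bessel_inequality) auto
  finally have "l2_norm S \<le> l2_norm f" by (rule power2_le_imp_le) (rule l2_norm_nonneg)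
  have "(\<Sum>k<N. z k * l2_inner f (e k) * l2_inner (e k) h) = l2_inner S h"
    unfolding S_def by (simp add: l2_inner_orthonormal_sum h)
  also have "cmod \<dots> \<le> l2_norm S * l2_norm h"
    unfolding S_def by (intro l2_cauchy_schwarz square_integrable_orthonormal_sum h)
  also have "\<dots> \<le> l2_norm f * l2_norm h"
    by (intro mult_right_mono \<open>l2_norm S \<le> l2_norm f\<close> l2_norm_nonneg)
  finally show ?thesis .
qed

end

section \<open>Orthogonality and parity of Hermite functions\<close>

lemma poly_gaussian_tendsto_0_at_top:
  "((\<lambda>x::real. poly p x * exp (- x\<^sup>2)) \<longlongrightarrow> 0) at_top"
proof -
  have "((\<lambda>x::real. \<Sum>k\<le>degree p. coeff p k * (x ^ k * exp (- x\<^sup>2))) \<longlongrightarrow> (\<Sum>k\<le>degree p. coeff p k * 0)) at_top"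
  proof (intro tendsto_sum tendsto_mult_left)
    show "((\<lambda>x::real. x ^ k * exp (- x\<^sup>2)) \<longlongrightarrow> 0) at_top" for k
      by real_asymp
  qed
  then show ?thesis
    by (simp add: poly_altdef sum_distrib_right mult.assoc)
qed

lemma poly_gaussian_tendsto_0_at_bot:
  "((\<lambda>x::real. poly p x * exp (- x\<^sup>2)) \<longlongrightarrow> 0) at_bot"
  using poly_gaussian_tendsto_0_at_top[of "pcompose p [:0, -1:]"]
  by (simp add: filterlim_at_bot_mirror poly_pcompose)

text \<open>The integrand is the derivative of \<open>poly p x * exp (- x^2)\<close>, which vanishes
  at both infinities.\<close>

lemma integral_deriv_poly_gaussian:
  fixes p :: "real poly"
  shows   "(LBINT x::real. poly (pderiv p - [:0, 2:] * p) x * exp (- x\<^sup>2)) = 0"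
proof -
  have "(LBINT x=-\<infinity>..\<infinity>. poly (pderiv p - [:0, 2:] * p) x * exp (- x\<^sup>2)) = 0 - 0"
  proof (rule interval_integral_FTC_integrable[where F = "\<lambda>x. poly p x * exp (- x\<^sup>2)"])
    show "((\<lambda>x. poly p x * exp (- x\<^sup>2)) has_vector_derivative
        poly (pderiv p - [:0, 2:] * p) x * exp (- x\<^sup>2)) (at x)" for x
      by (auto intro!: derivative_eq_intros simp: algebra_simps
          simp flip: has_real_derivative_iff_has_vector_derivative)
    show "isCont (\<lambda>x. poly (pderiv p - [:0, 2:] * p) x * exp (- x\<^sup>2)) x" for x
      by (intro continuous_intros)
    show "set_integrable lborel (einterval (- \<infinity>) \<infinity>) (\<lambda>x. poly (pderiv p - [:0, 2:] * p) x * exp (- x\<^sup>2))"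
      using integrable_poly_gaussian[of "pderiv p - [:0, 2:] * p"] by (simp add: set_integrable_def del: poly_diff)
  qed (use poly_gaussian_tendsto_0_at_top poly_gaussian_tendsto_0_at_bot in \<open>simp_all add: ereal_tendsto_simps\<close>)
  then show ?thesis
    by (simp add: interval_lebesgue_integral_def set_lebesgue_integral_def)
qed

text \<open>Hermite's equation \<open>p'' = 2 x p' - 2 n p\<close>: the eigenvalue equation for
  \<open>poly p x * exp (- x^2 / 2)\<close> with the Gaussian cancelled.\<close>

definition hermite_ode :: "nat \<Rightarrow> real poly \<Rightarrow> bool" where
  "hermite_ode n p \<longleftrightarrow> pderiv (pderiv p) = [:0, 2:] * pderiv p - smult (2 * real n) p"

text \<open>The specification of \<open>hermite\<close> only asserts that some \<open>f'\<close> and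
  \<open>f''\<close> exist. Uniqueness of derivatives identifies them with the explicit formulas,
  after which the positive Gaussian factor cancels.\<close>

lemma hermite_poly_gaussian:
  obtains p where "\<And>x. hermite n x = complex_of_real (poly p x * exp (- x\<^sup>2 / 2))" "hermite_ode n p"
proof -
  obtain p f' f'' where p: "\<And>x. hermite n x = complex_of_real (poly p x * exp (- x\<^sup>2 / 2))"
    and f': "\<And>x. (hermite n has_vector_derivative f' x) (at x)"
    and f'': "\<And>x. (f' has_vector_derivative f'' x) (at x)"
    and eq: "\<And>x. - f'' x + complex_of_real (x\<^sup>2) * hermite n x = of_nat (2 * n + 1) * hermite n x"
    using hermite_function_hermite[of n] unfolding hermite_function_def by blast
  have "(hermite n has_vector_derivative
      complex_of_real ((poly (pderiv p) x - x * poly p x) * exp (- x\<^sup>2 / 2))) (at x)" for x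
    unfolding p [abs_def] by (rule has_vector_derivative_of_real)
       (auto intro!: derivative_eq_intros simp: algebra_simps)
  then have f'_eq: "f' = (\<lambda>x. complex_of_real ((poly (pderiv p) x - x * poly p x) * exp (- x\<^sup>2 / 2)))"
    using f' vector_derivative_unique_at by blast
  have "(f' has_vector_derivative complex_of_real
     ((poly (pderiv (pderiv p)) x - poly p x - 2 * x * poly (pderiv p) x + x\<^sup>2 * poly p x) * exp (- x\<^sup>2 / 2)))
     (at x)" for x
    unfolding f'_eq by (rule has_vector_derivative_of_real)
       (auto intro!: derivative_eq_intros simp: algebra_simps power2_eq_square)
  then have f''_eq: "f'' x = complex_of_real
     ((poly (pderiv (pderiv p)) x - poly p x - 2 * x * poly (pderiv p) x + x\<^sup>2 * poly p x) * exp (- x\<^sup>2 / 2))" for x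
    using f'' vector_derivative_unique_at by blast
  have "poly (pderiv (pderiv p)) x = poly ([:0, 2:] * pderiv p - smult (2 * real n) p) x" for x
  proof -
    have "complex_of_real (- ((poly (pderiv (pderiv p)) x - poly p x - 2 * x * poly (pderiv p) x
          + x\<^sup>2 * poly p x) * exp (- x\<^sup>2 / 2)) + x\<^sup>2 * (poly p x * exp (- x\<^sup>2 / 2)))
        = complex_of_real (real (2 * n + 1) * (poly p x * exp (- x\<^sup>2 / 2)))"
      using eq[of x] unfolding f''_eq p by simp
    then have "(poly (pderiv (pderiv p)) x - (2 * x * poly (pderiv p) x - 2 * real n * poly p x))
        * exp (- x\<^sup>2 / 2) = 0"
      unfolding of_real_eq_iff by (simp add: algebra_simps)
    then show ?thesis by (simp add: mult.assoc)
  qed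
  then have "hermite_ode n p"
    unfolding hermite_ode_def by (simp add: fun_eq_iff flip: poly_eq_poly_eq_iff)
  with p show thesis by (rule that)
qed

lemma square_integrable_hermite: "square_integrable (hermite n)"
proof -
  obtain p where "\<And>x. hermite n x = complex_of_real (poly p x * exp (- x\<^sup>2 / 2))"
    using hermite_poly_gaussian[of n] by blast
  then have "hermite n = (\<lambda>x. complex_of_real (poly p x * exp (- x\<^sup>2 / 2)))" by auto
  then show ?thesis using square_integrable_poly_gaussian by simp
qed

text \<open>Abel's identity for the Wronskian \<open>W = p' q - p q'\<close>. The left side
  \<open>W' - 2 x W\<close> is exactly the form whose Gaussian integral vanishes by
  \<open>integral_deriv_poly_gaussian\<close>, which yields orthogonality for
  \<open>m \<noteq> n\<close>.\<close>

lemma hermite_ode_wronskian: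
  assumes p: "hermite_ode m p" and q: "hermite_ode n q"
  shows "pderiv (pderiv p * q - p * pderiv q) - [:0, 2:] * (pderiv p * q - p * pderiv q)
    = smult (2 * (real n - real m)) (p * q)"
proof -
  have "pderiv (pderiv p * q - p * pderiv q) = pderiv (pderiv p) * q - p * pderiv (pderiv q)"
    by (simp add: pderiv_diff pderiv_mult algebra_simps)
  also have "\<dots> = ([:0, 2:] * pderiv p - smult (2 * real m) p) * q - p * ([:0, 2:] * pderiv q - smult (2 * real n) q)"
    using p q by (simp only: hermite_ode_def)
  finally have *: "pderiv (pderiv p * q - p * pderiv q) = \<dots>" .
  have "poly (pderiv (pderiv p * q - p * pderiv q) - [:0, 2:] * (pderiv p * q - p * pderiv q)) x
    = poly (smult (2 * (real n - real m)) (p * q)) x" for x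
    unfolding * by (simp add: algebra_simps)
  then show ?thesis by (simp add: fun_eq_iff flip: poly_eq_poly_eq_iff)
qed

lemma l2_orthonormal_hermite: "l2_orthonormal hermite"
proof -
  have "l2_inner (hermite j) (hermite j) = 1" for j
    using hermite_function_hermite[of j] by (simp add: l2_inner_self hermite_function_def)
  moreover have "l2_inner (hermite m) (hermite n) = 0" if "m \<noteq> n" for m n
  proof -
    obtain p where p: "\<And>x. hermite m x = complex_of_real (poly p x * exp (- x\<^sup>2 / 2))" "hermite_ode m p"
      using hermite_poly_gaussian[of m] by blast
    obtain q where q: "\<And>x. hermite n x = complex_of_real (poly q x * exp (- x\<^sup>2 / 2))" "hermite_ode n q"
      using hermite_poly_gaussian[of n] by blast
    have "2 * (real n - real m) * (LBINT x. poly (p * q) x * exp (- x\<^sup>2)) = 0"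
      using integral_deriv_poly_gaussian[of "pderiv p * q - p * pderiv q"]
      unfolding hermite_ode_wronskian[OF p(2) q(2)] by (simp add: mult.assoc)
    then have 0: "(LBINT x. poly (p * q) x * exp (- x\<^sup>2)) = 0" using that by simp
    have "hermite m x * cnj (hermite n x) = complex_of_real (poly (p * q) x * exp (- x\<^sup>2))" for x
    proof -
      have "exp (- x\<^sup>2 / 2) * exp (- x\<^sup>2 / 2) = exp (- x\<^sup>2)" by (simp flip: exp_add)
      then have "poly p x * exp (- x\<^sup>2 / 2) * (poly q x * exp (- x\<^sup>2 / 2)) = poly (p * q) x * exp (- x\<^sup>2)"
        by (simp add: mult_ac)
      then show ?thesis unfolding p(1) q(1) complex_cnj_complex_of_real by (simp only: flip: of_real_mult)
    qed
    then show ?thesis unfolding l2_inner_def by (simp only: integral_complex_of_real 0 of_real_0)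
  qed
  ultimately show ?thesis by (auto simp: l2_orthonormal_def square_integrable_hermite)
qed

text \<open>Compare coefficients at the degree of \<open>p\<close>: the second derivative
  contributes nothing, and the rest is \<open>2 (degree p - n)\<close> times the leading
  coefficient.\<close>

lemma hermite_ode_degree:
  assumes "hermite_ode n p" "p \<noteq> 0"
  shows "degree p = n"
proof (rule ccontr)
  assume neq: "degree p \<noteq> n"
  have "coeff (pderiv (pderiv p)) (degree p) = 0"
    by (simp add: coeff_pderiv coeff_eq_0)
  moreover have "coeff ([:0, 2:] * pderiv p) (degree p) = 2 * real (degree p) * lead_coeff p"
    by (cases "degree p") (simp_all add: coeff_pderiv)
  moreover have "coeff (pderiv (pderiv p)) (degree p) = coeff ([:0, 2:] * pderiv p - smult (2 * real n) p) (degree p)"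
    using assms(1) by (simp only: hermite_ode_def)
  ultimately have "2 * real (degree p) * lead_coeff p - 2 * real n * lead_coeff p = 0"
    by (simp only: coeff_diff coeff_smult)
  then have "(real (degree p) - real n) * lead_coeff p = 0" by (simp add: algebra_simps)
  then show False using neq assms(2) by simp
qed

text \<open>The equation is invariant under reflection, so \<open>r\<close> solves it as well. The
  sign in \<open>r\<close> is chosen to cancel the coefficient at \<open>n\<close>, but a nonzero
  solution has degree exactly \<open>n\<close>; hence \<open>r = 0\<close>.\<close>

lemma hermite_ode_parity:
  assumes "hermite_ode n p"
  shows "poly p (- x) = (-1) ^ n * poly p x"
proof (cases "p = 0")
  case False
  define q where "q = pcompose p [:0, -1:]"
  define r where "r = q - smult ((-1) ^ n) p"
  have deg: "degree p = n" using assms False by (rule hermite_ode_degree)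
  have dq: "pderiv q = - pcompose (pderiv p) [:0, -1:]"
    by (simp add: q_def pderiv_pcompose pderiv_pCons)
  have ddq: "pderiv (pderiv q) = pcompose (pderiv (pderiv p)) [:0, -1:]"
    by (simp add: dq pderiv_minus pderiv_pcompose pderiv_pCons)
  have "poly (pderiv (pderiv q)) x = poly ([:0, 2:] * pderiv q - smult (2 * real n) q) x" for x
    using assms unfolding ddq unfolding dq hermite_ode_def by (simp add: q_def poly_pcompose)
  then have q: "hermite_ode n q"
    unfolding hermite_ode_def by (simp add: fun_eq_iff flip: poly_eq_poly_eq_iff)
  have "poly (pderiv (pderiv r)) x = poly ([:0, 2:] * pderiv r - smult (2 * real n) r) x" for x
    unfolding r_def pderiv_diff pderiv_smult q [unfolded hermite_ode_def] assms [unfolded hermite_ode_def]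
    by (simp add: algebra_simps)
  then have r: "hermite_ode n r"
    unfolding hermite_ode_def by (simp add: fun_eq_iff flip: poly_eq_poly_eq_iff)
  have "coeff q n = (-1) ^ n * coeff p n"
    unfolding q_def by (rule coeff_pcompose_linear)
  then have "coeff r n = 0" by (simp add: r_def)
  then have "r = 0" using hermite_ode_degree[OF r] by (metis leading_coeff_0_iff)
  then have "poly q x = (-1) ^ n * poly p x" by (simp add: r_def)
  then show ?thesis by (simp add: q_def poly_pcompose)
qed simp

lemma hermite_parity: "hermite n (- x) = (-1) ^ n * hermite n x"
proof -
  obtain p where p: "\<And>x. hermite n x = complex_of_real (poly p x * exp (- x\<^sup>2 / 2))" "hermite_ode n p"
    using hermite_poly_gaussian[of n] by blast
  show ?thesis unfolding p(1) hermite_ode_parity[OF p(2)] by simp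
qed

section \<open>Time averages and stationary waves\<close>

lemma l2_norm_0: "l2_norm (\<lambda>x. 0) = 0"
  by (simp add: l2_norm_def)

section \<open>Existence and linearity of the propagator, and its action on eigenfunctions\<close>

lemma propagator_exists:
  assumes "square_integrable f"
  shows "\<exists>g. propagator t f g"
proof -
  define c where "c = (\<lambda>k. exp (\<i> * complex_of_real t * of_nat (2 * k + 1)) * l2_inner f (hermite k))"
  have "cmod (c k) = cmod (l2_inner f (hermite k))" for k
    by (simp add: c_def norm_mult)
  then have "summable (\<lambda>k. (cmod (c k))\<^sup>2)"
    using bessel_summable[OF l2_orthonormal_hermite assms] by simp
  then obtain g where "square_integrable g" "(\<lambda>N. l2_norm (\<lambda>x. g x - (\<Sum>k<N. c k * hermite k x))) \<longlonglongrightarrow> 0"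
    by (rule riesz_fischer[OF l2_orthonormal_hermite])
  then show ?thesis
    using assms unfolding propagator_def c_def by blast
qed

lemma propagator_cmult:
  assumes "propagator t f g"
  shows "propagator t (\<lambda>x. a * f x) (\<lambda>x. a * g x)"
proof -
  let ?E = "\<lambda>f g N x. g x - (\<Sum>k<N. exp (\<i> * complex_of_real t * of_nat (2 * k + 1)) *
                                      l2_inner f (hermite k) * hermite k x)"
  have "?E (\<lambda>x. a * f x) (\<lambda>x. a * g x) N = (\<lambda>x. a * ?E f g N x)" for N
    by (simp add: fun_eq_iff l2_inner_cmult_left right_diff_distrib sum_distrib_left mult_ac)
  then have "l2_norm (?E (\<lambda>x. a * f x) (\<lambda>x. a * g x) N) = cmod a * l2_norm (?E f g N)" for N
    by (simp only: l2_norm_cmult)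
  moreover have "(\<lambda>N. cmod a * l2_norm (?E f g N)) \<longlonglongrightarrow> 0"
    using assms unfolding propagator_def by (intro tendsto_mult_right_zero) blast
  ultimately show ?thesis
    using assms unfolding propagator_def by (simp add: square_integrable_cmult)
qed

text \<open>The expansion has a single nonzero term, so the partial sums are exact once
  \<open>N > n\<close>.\<close>

lemma propagator_hermite:
  "propagator t (hermite n) (\<lambda>x. exp (\<i> * complex_of_real t * of_nat (2 * n + 1)) * hermite n x)"
proof -
  let ?z = "\<lambda>k. exp (\<i> * complex_of_real t * of_nat (2 * k + 1))"
  have inner: "l2_inner (hermite n) (hermite k) = (if k = n then 1 else 0)" for k
    using l2_orthonormal_hermite unfolding l2_orthonormal_def by auto
  have "(\<Sum>k<N. ?z k * l2_inner (hermite n) (hermite k) * hermite k x) = ?z n * hermite n x" if "N > n" for N x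
  proof -
    have "(\<Sum>k<N. ?z k * l2_inner (hermite n) (hermite k) * hermite k x)
        = (\<Sum>k<N. if k = n then ?z k * hermite k x else 0)"
      by (intro sum.cong) (auto simp: inner)
    then show ?thesis using that by simp
  qed
  then have "\<forall>\<^sub>F N in sequentially. l2_norm (\<lambda>x. ?z n * hermite n x -
      (\<Sum>k<N. ?z k * l2_inner (hermite n) (hermite k) * hermite k x)) = 0"
    by (intro eventually_mono[OF eventually_gt_at_top[of n]]) (simp add: l2_norm_0)
  then show ?thesis
    unfolding propagator_def
    by (auto intro: square_integrable_hermite square_integrable_cmult tendsto_eventually)
qed

text \<open>For \<open>m = 2 * j\<close> nonzero, the exponents at the two endpoints differ by
  \<open>2 * pi * \<i> * j\<close>, so the antiderivative takes equal values there.\<close>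

lemma integral_exp_even_frequency:
  fixes m :: int
  assumes "even m"
  shows "(LBINT s:{-pi/4..pi/4}. exp (2 * \<i> * complex_of_real s * of_int m)) = (if m = 0 then complex_of_real (pi / 2) else 0)"
proof (cases "m = 0")
  case True
  then show ?thesis by (simp add: set_lebesgue_integral_def scaleR_conv_of_real)
next
  case False
  define F where "F = (\<lambda>s. exp (2 * \<i> * complex_of_real s * of_int m) / (2 * \<i> * of_int m))"
  have "(LBINT s. indicator {-pi/4..pi/4} s *\<^sub>R exp (2 * \<i> * complex_of_real s * of_int m)) = F (pi / 4) - F (- pi / 4)"
  proof (rule integral_FTC_atLeastAtMost)
    show "(F has_vector_derivative exp (2 * \<i> * complex_of_real s * of_int m)) (at s within {-pi/4..pi/4})" for s
      unfolding F_def using False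
      by (auto intro!: derivative_eq_intros has_vector_derivative_real_field)
    show "continuous_on {-pi/4..pi/4} (\<lambda>s. exp (2 * \<i> * complex_of_real s * of_int m))"
      by (intro continuous_intros)
  qed simp
  moreover have "F (pi / 4) = F (- pi / 4)"
  proof -
    obtain j where m: "m = 2 * j" using assms by (rule evenE)
    have "2 * \<i> * complex_of_real (pi / 4) * of_int m
        = 2 * \<i> * complex_of_real (- pi / 4) * of_int m + \<i> * (of_int j * (of_real pi * 2))"
      unfolding m by (simp add: field_simps)
    then show ?thesis by (simp only: F_def exp_add exp_2pi_1_int mult_1_right)
  qed
  ultimately show ?thesis using False by (simp add: set_lebesgue_integral_def)
qed

text \<open>The exponential with \<open>2 * n + 1\<close> is the phase that the forward evolution of
  \<open>hermite n\<close> leaves on the nonlinearity. After pairing with \<open>h\<close> the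
  series is integrated term by term; the surviving factor \<open>pi / 2\<close> is the length of the
  window.\<close>

lemma time_average_hermite:
  assumes F: "square_integrable F"
    and parity: "\<And>k. odd (n + k) \<Longrightarrow> l2_inner F (hermite k) = 0"
    and w: "\<And>s. propagator (- s) F (w s)"
  shows "has_l2_integral (\<lambda>s x. c * (exp (\<i> * complex_of_real s * of_nat (2 * n + 1)) * w s x))
     (\<lambda>x. c * (pi / 2) * l2_inner F (hermite n) * hermite n x) (- pi / 4) (pi / 4)"
proof -
  define I where "I = {- pi / 4..pi / 4}"
  define z where "z = (\<lambda>s k. exp (\<i> * complex_of_real s * of_nat (2 * n + 1)) * exp (\<i> * complex_of_real (- s) * of_nat (2 * k + 1)))"
  have z: "z s k = exp (2 * \<i> * complex_of_real s * of_int (int n - int k))" for s k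
    by (simp add: z_def algebra_simps flip: exp_add)
  have cmod_z: "cmod (z s k) = 1" for s k by (simp add: z_def norm_mult)
  have sq_w: "square_integrable (w s)" for s using w[of s] by (simp add: propagator_def)
  have main: "set_integrable lborel I (\<lambda>s. l2_inner (\<lambda>x. exp (\<i> * complex_of_real s * of_nat (2 * n + 1)) * w s x) h) \<and>
    (LBINT s:I. l2_inner (\<lambda>x. exp (\<i> * complex_of_real s * of_nat (2 * n + 1)) * w s x) h)
      = (pi / 2) * l2_inner F (hermite n) * l2_inner (hermite n) h"
    if h: "square_integrable h" for h
  proof -
    define a where "a = (\<lambda>k. l2_inner F (hermite k) * l2_inner (hermite k) h)"
    define u where "u = (\<lambda>s. l2_inner (\<lambda>x. exp (\<i> * complex_of_real s * of_nat (2 * n + 1)) * w s x) h)"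
    define v where "v = (\<lambda>N s. indicator I s *\<^sub>R (\<Sum>k<N. z s k * a k))"
    \<comment> \<open>A constant majorant on a bounded window, supplied by
      \<open>multiplier_bound\<close>.\<close>
    define B where "B = (\<lambda>s. indicator I s *\<^sub>R (l2_norm F * l2_norm h))"
    have lim: "(\<lambda>N. v N s) \<longlonglongrightarrow> indicator I s *\<^sub>R u s" for s
    proof -
      have "(\<lambda>N. \<Sum>k<N. exp (\<i> * complex_of_real (- s) * of_nat (2 * k + 1)) * l2_inner F (hermite k) * l2_inner (hermite k) h)
          \<longlonglongrightarrow> l2_inner (w s) h"
        using w[of s] h unfolding propagator_def
        by (intro tendsto_l2_inner_expansion[OF l2_orthonormal_hermite]) auto
      then have "(\<lambda>N. indicator I s *\<^sub>R (exp (\<i> * complex_of_real s * of_nat (2 * n + 1)) *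
          (\<Sum>k<N. exp (\<i> * complex_of_real (- s) * of_nat (2 * k + 1)) * l2_inner F (hermite k) * l2_inner (hermite k) h)))
          \<longlonglongrightarrow> indicator I s *\<^sub>R u s"
        unfolding u_def l2_inner_cmult_left by (intro tendsto_intros)
      then show ?thesis
        by (simp only: v_def z_def a_def sum_distrib_left mult.assoc)
    qed
    have term_int: "set_integrable lborel I (\<lambda>s. z s k * a k)" for k
      unfolding z I_def by (intro borel_integrable_atLeastAtMost' continuous_intros)
    have v_int: "integrable lborel (v N)" for N
      using term_int unfolding v_def set_integrable_def scaleR_sum_right
      by (intro Bochner_Integration.integrable_sum)
    have [measurable]: "v N \<in> borel_measurable lborel" for N
      using v_int by (rule borel_measurable_integrable)
    \<comment> \<open>Each \<open>w s\<close> is given separately, with no regularity assumed in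
      \<open>s\<close>; measurability is inherited from the partial sums as their pointwise
      limit.\<close>
    have [measurable]: "(\<lambda>s. indicator I s *\<^sub>R u s) \<in> borel_measurable lborel"
      by (rule borel_measurable_LIMSEQ_metric[where f = v]) (use lim in auto)
    have B_int: "integrable lborel B"
      unfolding B_def I_def by (intro integrable_scaleR_left integrable_real_indicator) simp_all
    have bound: "AE s in lborel. norm (v N s) \<le> B s" for N
    proof (rule AE_I2)
      fix s
      show "norm (v N s) \<le> B s"
        using multiplier_bound[where z = "z s" and N = N, OF l2_orthonormal_hermite F h cmod_z]
        by (simp add: v_def B_def a_def mult.assoc split: split_indicator)
    qed
    have u_int: "integrable lborel (\<lambda>s. indicator I s *\<^sub>R u s)"
      by (rule integrable_dominated_convergence[where w = B and s = v]) (use B_int lim bound in auto)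
    have u_lim: "(\<lambda>N. integral\<^sup>L lborel (v N)) \<longlonglongrightarrow> (LBINT s. indicator I s *\<^sub>R u s)"
      by (rule integral_dominated_convergence[where w = B]) (use B_int lim bound in auto)
    have term_val: "(LBINT s:I. z s k * a k) = (if k = n then (pi / 2) * a n else 0)" for k
    proof (cases "odd (n + k)")
      case True
      \<comment> \<open>In this case the phase integral is not zero; the coefficient is.\<close>
      then have "a k = 0" "k \<noteq> n" using parity[of k] by (auto simp: a_def)
      then show ?thesis by (simp add: set_lebesgue_integral_def)
    next
      case False
      then have "even (int n - int k)" by simp
      from integral_exp_even_frequency[OF this]
      have "(LBINT s:I. z s k) = (if k = n then complex_of_real (pi / 2) else 0)"
        unfolding z I_def by auto
      then show ?thesis by simp
    qed
    have "integral\<^sup>L lborel (v N) = (pi / 2) * a n" if "N > n" for N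
    proof -
      have "integral\<^sup>L lborel (v N) = (\<Sum>k<N. (LBINT s:I. z s k * a k))"
        using term_int unfolding v_def set_integrable_def set_lebesgue_integral_def scaleR_sum_right
        by (intro Bochner_Integration.integral_sum)
      then show ?thesis unfolding term_val using that by simp
    qed
    then have "\<forall>\<^sub>F N in sequentially. integral\<^sup>L lborel (v N) = (pi / 2) * a n"
      by (rule eventually_mono[OF eventually_gt_at_top[of n]])
    then have "(\<lambda>N. integral\<^sup>L lborel (v N)) \<longlonglongrightarrow> (pi / 2) * a n"
      by (rule tendsto_eventually)
    then have "(LBINT s. indicator I s *\<^sub>R u s) = (pi / 2) * a n"
      using u_lim LIMSEQ_unique by blast
    then show ?thesis
      using u_int by (simp add: u_def a_def set_integrable_def set_lebesgue_integral_def mult.assoc)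
  qed
  show ?thesis
    unfolding has_l2_integral_def I_def [symmetric]
  proof (intro conjI allI impI ballI)
    fix h assume h: "square_integrable h"
    show "set_integrable lborel I (\<lambda>s. l2_inner (\<lambda>x. c * (exp (\<i> * complex_of_real s * of_nat (2 * n + 1)) * w s x)) h)"
      unfolding l2_inner_cmult_left[of c] using main[OF h] by (intro set_integrable_mult_right) blast
    show "(LBINT s:I. l2_inner (\<lambda>x. c * (exp (\<i> * complex_of_real s * of_nat (2 * n + 1)) * w s x)) h)
        = l2_inner (\<lambda>x. c * (pi / 2) * l2_inner F (hermite n) * hermite n x) h"
      using main[OF h] by (simp only: l2_inner_cmult_left set_integral_mult_right mult.assoc)
  qed (intro square_integrable_cmult sq_w square_integrable_hermite)+
qed

section \<open>The nonlinearity built from a Hermite function\<close>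

context
  fixes p n :: nat and F :: "real \<Rightarrow> complex"
  defines "F \<equiv> \<lambda>x. complex_of_real (cmod (hermite n x) ^ p) * hermite n x"
begin

text \<open>One of the \<open>p + 1\<close> Gaussian factors is enough for integrability. The other
  \<open>p\<close> are bounded by 1, leaving the polynomial \<open>q ^ p * q\<close> times a
  Gaussian as majorant.\<close>

lemma square_integrable_nonlinearity: "square_integrable F"
proof -
  obtain q where q: "\<And>x. hermite n x = complex_of_real (poly q x * exp (- x\<^sup>2 / 2))"
    using hermite_poly_gaussian[of n] by blast
  have [measurable]: "hermite n \<in> borel_measurable borel"
    using square_integrable_hermite by (rule square_integrable_measurable)
  define r where "r = q ^ p * q"
  have int: "integrable lborel (\<lambda>x. (cmod (complex_of_real (poly r x * exp (- x\<^sup>2 / 2))))\<^sup>2)"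
    by (intro square_integrable_cmod2 square_integrable_poly_gaussian)
  have "cmod (F x) \<le> cmod (complex_of_real (poly r x * exp (- x\<^sup>2 / 2)))" for x
  proof -
    have "exp (- x\<^sup>2 / 2) ^ p \<le> 1" by (intro power_le_one) auto
    then have "\<bar>poly q x\<bar> ^ p * exp (- x\<^sup>2 / 2) ^ p * (\<bar>poly q x\<bar> * exp (- x\<^sup>2 / 2))
        \<le> \<bar>poly q x\<bar> ^ p * 1 * (\<bar>poly q x\<bar> * exp (- x\<^sup>2 / 2))"
      by (intro mult_right_mono mult_left_mono) auto
    then show ?thesis
      by (simp add: F_def q r_def norm_mult norm_power abs_mult power_mult_distrib power_abs mult.assoc
          del: of_real_mult of_real_power of_real_exp)
  qed
  then have "(cmod (F x))\<^sup>2 \<le> (cmod (complex_of_real (poly r x * exp (- x\<^sup>2 / 2))))\<^sup>2" for x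
    by (rule power_mono) simp
  moreover have "(\<lambda>x. (cmod (F x))\<^sup>2) \<in> borel_measurable lborel"
    unfolding F_def by measurable
  ultimately have "integrable lborel (\<lambda>x. (cmod (F x))\<^sup>2)"
    by (intro Bochner_Integration.integrable_bound[OF int]) auto
  then show ?thesis by (simp add: square_integrable_def F_def)
qed

lemma l2_inner_nonlinearity_parity:
  assumes "odd (n + k)"
  shows "l2_inner F (hermite k) = 0"
proof -
  define G where "G = (\<lambda>x. F x * cnj (hermite k x))"
  have "(-1 :: complex) ^ n * (-1) ^ k = -1" using assms by (simp flip: power_add)
  then have "(-1) ^ n * ((-1) ^ k * z) = - z" for z :: complex
    by (metis mult.assoc mult_minus1)
  moreover have "G (- x) = (-1) ^ n * ((-1) ^ k * G x)" for x
    by (simp add: G_def F_def hermite_parity norm_mult norm_power mult_ac)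
  ultimately have "G (- x) = - G x" for x by simp
  \<comment> \<open>Reflection preserves Lebesgue measure, so the integral of the odd function
    equals its own negative.\<close>
  then have "integral\<^sup>L lborel G = - integral\<^sup>L lborel G"
    using lborel_integral_real_affine[of "-1" G 0] by simp
  then show ?thesis by (simp add: l2_inner_def G_def)
qed

text \<open>The integrand is the modulus of \<open>hermite n\<close> to the power
  \<open>p + 2\<close>. This is what makes the frequency of the stationary wave real.\<close>

lemma l2_inner_nonlinearity_real: "l2_inner F (hermite n) \<in> \<real>"
proof -
  have "F x * cnj (hermite n x) = complex_of_real (cmod (hermite n x) ^ p * (cmod (hermite n x))\<^sup>2)" for x
    unfolding of_real_mult complex_norm_square F_def by (simp add: mult.assoc)
  then show ?thesis
    unfolding l2_inner_def by (simp only: integral_complex_of_real Reals_of_real)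
qed

text \<open>Being unimodular, \<open>a\<close> disappears from \<open>cmod (v s x) ^ p\<close> and
  passes linearly through the rest. It will be the time phase of the wave.\<close>

lemma resonant_operator_hermite:
  assumes "cmod a = 1"
  shows "resonant_operator c p (\<lambda>x. a * hermite n x)
    (\<lambda>x. complex_of_real c * (pi / 2) * l2_inner F (hermite n) * (a * hermite n x))"
proof -
  define E where "E = (\<lambda>s. exp (\<i> * complex_of_real s * of_nat (2 * n + 1)))"
  have cmod_E: "cmod (E s) = 1" for s by (simp add: E_def)
  have "\<forall>s. \<exists>g. propagator (- s) F g"
    using propagator_exists[OF square_integrable_nonlinearity] by blast
  then obtain w where w: "\<And>s. propagator (- s) F (w s)"
    by metis
  define v where "v = (\<lambda>s x. a * (E s * hermite n x))"
  have "propagator s (\<lambda>x. a * hermite n x) (v s)" for s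
    unfolding v_def E_def by (intro propagator_cmult propagator_hermite)
  moreover have "propagator (- s) (\<lambda>x. complex_of_real (cmod (v s x) ^ p) * v s x) (\<lambda>x. a * E s * w s x)" for s
  proof -
    have "(\<lambda>x. complex_of_real (cmod (v s x) ^ p) * v s x) = (\<lambda>x. a * E s * F x)"
      by (simp add: v_def F_def norm_mult assms cmod_E mult_ac)
    then show ?thesis using propagator_cmult[OF w] by simp
  qed
  moreover have "has_l2_integral (\<lambda>s x. complex_of_real c * (a * E s * w s x))
      (\<lambda>x. complex_of_real c * (pi / 2) * l2_inner F (hermite n) * (a * hermite n x)) (- pi / 4) (pi / 4)"
    using time_average_hermite[where c = "complex_of_real c * a",
        OF square_integrable_nonlinearity l2_inner_nonlinearity_parity w]
    by (simp add: E_def mult_ac)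
  ultimately show ?thesis
    unfolding resonant_operator_def by (intro exI[of _ v] exI[of _ "\<lambda>s x. a * E s * w s x"] conjI ballI)
qed

end

text \<open>The error of the difference quotient is a scalar multiple of \<open>\<psi>\<close>, so
  the L2 limit reduces to differentiating the complex exponential along real increments.\<close>

lemma has_l2_derivative_phase:
  assumes "square_integrable \<psi>"
  shows "has_l2_derivative (\<lambda>t x. exp (\<i> * complex_of_real (\<omega> * t)) * \<psi> x)
     (\<lambda>x. \<i> * complex_of_real \<omega> * exp (\<i> * complex_of_real (\<omega> * t)) * \<psi> x) t"
proof -
  define E where "E = (\<lambda>t. exp (\<i> * complex_of_real (\<omega> * t)))"
  define E' where "E' = \<i> * complex_of_real \<omega> * E t"
  have "((\<lambda>z. exp (\<i> * complex_of_real \<omega> * z)) has_field_derivative E') (at (complex_of_real t))"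
    unfolding E_def E'_def by (auto intro!: derivative_eq_intros simp: mult_ac)
  moreover have "filterlim complex_of_real (at 0) (at 0)"
    by (rule filterlim_atI) (auto intro!: tendsto_eq_intros simp: eventually_at_filter)
  ultimately have "((\<lambda>h. (E (t + h) - E t) / complex_of_real h) \<longlongrightarrow> E') (at 0)"
    unfolding DERIV_def by (drule_tac filterlim_compose) (simp_all add: E_def mult_ac)
  then have "((\<lambda>h. cmod ((E (t + h) - E t) / complex_of_real h - E') * l2_norm \<psi>) \<longlongrightarrow> 0) (at 0)"
    by (intro tendsto_mult_left_zero tendsto_norm_zero LIM_zero)
  moreover have "l2_norm (\<lambda>x. (E (t + h) * \<psi> x - E t * \<psi> x) / complex_of_real h - E' * \<psi> x)
      = cmod ((E (t + h) - E t) / complex_of_real h - E') * l2_norm \<psi>" for h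
    by (subst l2_norm_cmult [symmetric]) (simp add: left_diff_distrib diff_divide_distrib)
  ultimately show ?thesis
    using assms unfolding has_l2_derivative_def E'_def E_def by (simp add: square_integrable_cmult)
qed

lemma stationary_wave_hermite: "stationary_wave (resonant_operator c p) (hermite n)"
proof -
  define F where "F = (\<lambda>x. complex_of_real (cmod (hermite n x) ^ p) * hermite n x)"
  obtain r where r: "l2_inner F (hermite n) = complex_of_real r"
    using l2_inner_nonlinearity_real[of n p] unfolding F_def by (auto elim: Reals_cases)
  \<comment> \<open>For this wave \<open>\<i> u_t = - \<omega> u\<close>, while the operator
    multiplies by \<open>c * (pi / 2) * r\<close>; hence the minus sign.\<close>
  define \<omega> where "\<omega> = - (c * (pi / 2) * r)"
  have "resonant_operator c p (\<lambda>x. exp (\<i> * complex_of_real (\<omega> * t)) * hermite n x)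
     (\<lambda>x. \<i> * (\<i> * complex_of_real \<omega> * exp (\<i> * complex_of_real (\<omega> * t)) * hermite n x))" for t
    using resonant_operator_hermite[of "exp (\<i> * complex_of_real (\<omega> * t))" c p n]
    unfolding F_def [symmetric] r by (simp add: \<omega>_def mult.assoc)
  then have "solves (resonant_operator c p) (\<lambda>t x. exp (\<i> * complex_of_real (\<omega> * t)) * hermite n x)"
    using has_l2_derivative_phase[OF square_integrable_hermite] unfolding solves_def by blast
  then show ?thesis unfolding stationary_wave_def by blast
qed

theorem mainTheorem16:
  fixes n :: nat
  shows "stationary_wave T6 (hermite n) \<and> stationary_wave T4 (hermite n)"
  unfolding T6_def T4_def by (intro conjI stationary_wave_hermite)

end
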